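(* Let $A\in\mathbb{R}^{n\times n}$ be symmetric positive definite with spectral decomposition $A=V\Lambda V^T+V_\perp\Lambda_\perp V_\perp^T$, where $(V,V_\perp)$ is an orthogonal matrix, $V\in\mathbb{R}^{n\times r}$, $\Lambda=\mathrm{diag}(\lambda_1,\dots,\lambda_r)$, $\Lambda_\perp=\mathrm{diag}(\lambda_{r+1},\dots,\lambda_n)$, $1\le r<n$, and every diagonal entry of $\Lambda$ is at most every diagonal entry of $\Lambda_\perp$. Let $\tilde E=V^TAV$ and let $\tilde H\in\mathbb{R}^{r\times r}$ be an invertible matrix. Let $\bar P_D=I-AV\tilde H^{-1}V^T$ and $\rho=\tilde E\tilde H^{-1}-I$. If the eigenvalues of $\bar P_DA$ are real, then every eigenvalue of $\bar P_DA$ satisfies $$-\xi_D\le\lambda(\bar P_DA)\le\lambda_{\max}(\Lambda_\perp)+\xi_D,$$ where $\xi_D=\|\rho\|_2\|\Lambda\|_2$.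
   Context: $\|\cdot\|_2$ is the spectral norm, $\lambda(\cdot)$ denotes an arbitrary eigenvalue, and $\lambda_{\max}$ the largest eigenvalue. The matrix $\tilde H$ is thought of as an approximation to $\tilde E$. *)

theory Defs
  imports "HOL-Analysis.Analysis"
begin

definition eigenvalue_of :: "'a::field ^ 'n ^ 'n \<Rightarrow> 'a \<Rightarrow> bool" where
  "eigenvalue_of M l \<longleftrightarrow> (\<exists>x. x \<noteq> 0 \<and> M *v x = l *s x)"

text \<open>
  The eigenvalues of a real, not necessarily symmetric, matrix \<open>M\<close> are by convention the complex
  ones, that is, the \<open>l\<close> with \<open>eigenvalue_of (map_matrix complex_of_real M) l\<close>.
\<close>

text \<open>Only used for symmetric matrices, all of whose eigenvalues are real.\<close>

definition lambda_max :: "real ^ 'n ^ 'n \<Rightarrow> real" where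
  "lambda_max M = Max {l. eigenvalue_of M l}"

text \<open>The library's \<open>norm\<close> on matrices is the Frobenius norm, hence the operator norm here.\<close>

definition spectral_norm :: "real ^ 'm ^ 'n \<Rightarrow> real" where
  "spectral_norm M = onorm (\<lambda>x. M *v x)"

definition symmetric_positive_definite :: "real ^ 'n ^ 'n \<Rightarrow> bool" where
  "symmetric_positive_definite A \<longleftrightarrow>
     transpose A = A \<and> (\<forall>x. x \<noteq> 0 \<longrightarrow> x \<bullet> (A *v x) > 0)"

definition diag :: "'a::zero ^ 'n \<Rightarrow> 'a ^ 'n ^ 'n" where
  "diag d = (\<chi> i j. if i = j then d $ i else 0)"

text \<open>The block matrix \<open>(V, W)\<close>.\<close>

definition append_columns :: "'a ^ 'r ^ 'n \<Rightarrow> 'a ^ 's ^ 'n \<Rightarrow> 'a ^ ('r + 's) ^ 'n" where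
  "append_columns V W = (\<chi> i k. case k of Inl j \<Rightarrow> V $ i $ j | Inr j \<Rightarrow> W $ i $ j)"

text \<open>
  The defining condition of \<open>orthogonal_matrix\<close>, with rows and columns indexed by possibly
  different types: \<open>append_columns V W\<close> has row index type \<open>'n\<close> and column index type
  \<open>'r + 's\<close>, so \<open>orthogonal_matrix\<close> itself does not apply. The two equations force both index
  types to have the same cardinality.
\<close>

definition orthogonal_mat :: "real ^ 'm ^ 'n \<Rightarrow> bool" where
  "orthogonal_mat Q \<longleftrightarrow> transpose Q ** Q = mat 1 \<and> Q ** transpose Q = mat 1"

end

theory Submission
  imports Defs
begin

text \<open>
  Since \<open>A V = V \<Lambda>\<close>, the matrix \<open>E\<close> is \<open>\<Lambda>\<close>, and substituting \<open>E H\<^sup>-\<^sup>1 = I + \<rho>\<close> yields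
  \<open>P A = V\<^sub>p \<Lambda>\<^sub>p V\<^sub>p\<^sup>T - V \<rho> \<Lambda> V\<^sup>T\<close>. In the orthonormal basis \<open>(V, V\<^sub>p)\<close> this matrix is block
  diagonal, so that an eigenvalue of \<open>P A\<close> is either one of \<open>\<Lambda>\<^sub>p\<close>, hence positive, or one of
  \<open>- \<rho> \<Lambda>\<close>, hence of modulus at most the spectral norm of \<open>\<rho> \<Lambda>\<close>.
\<close>

lemma sum_UNIV_Plus:
  fixes f :: "'a::finite + 'b::finite \<Rightarrow> 'c::comm_monoid_add"
  shows "(\<Sum>k\<in>UNIV. f k) = (\<Sum>i\<in>UNIV. f (Inl i)) + (\<Sum>j\<in>UNIV. f (Inr j))"
  by (simp add: sum.Plus flip: UNIV_Plus_UNIV)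

lemma matrix_add_rdistrib:
  fixes A B :: "'a::semiring_1 ^ 'n ^ 'm"
  shows "(A + B) ** C = A ** C + B ** C"
  by (simp add: vec_eq_iff matrix_matrix_mult_def distrib_right sum.distrib)

lemma matrix_diff_ldistrib:
  fixes A :: "'a::ring_1 ^ 'n ^ 'm"
  shows "A ** (B - C) = A ** B - A ** C"
  by (simp add: vec_eq_iff matrix_matrix_mult_def right_diff_distrib sum_subtractf)

lemma matrix_diff_rdistrib:
  fixes A B :: "'a::ring_1 ^ 'n ^ 'm"
  shows "(A - B) ** C = A ** C - B ** C"
  by (simp add: vec_eq_iff matrix_matrix_mult_def left_diff_distrib sum_subtractf)

lemma matrix_mult_zero_left [simp]: "0 ** A = (0 :: 'a::semiring_1 ^ 'n ^ 'm)"
  by (simp add: vec_eq_iff matrix_matrix_mult_def)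

lemma matrix_mult_zero_right [simp]: "A ** 0 = (0 :: 'a::semiring_1 ^ 'n ^ 'm)"
  by (simp add: vec_eq_iff matrix_matrix_mult_def)

text \<open>The first four equations are the blocks of \<open>transpose Q ** Q = mat 1\<close> for
  \<open>Q = append_columns V W\<close>. The last is \<open>Q ** transpose Q = mat 1\<close>, whose
  inner sum over \<open>'r + 's\<close> splits in two.\<close>

lemma orthogonal_mat_append_columnsD:
  fixes V :: "real ^ 'r ^ 'n" and W :: "real ^ 's ^ 'n"
  assumes "orthogonal_mat (append_columns V W)"
  shows "transpose V ** V = mat 1" "transpose W ** W = mat 1"
    "transpose V ** W = 0" "transpose W ** V = 0"
    "V ** transpose V + W ** transpose W = mat 1"
proof -
  let ?Q = "append_columns V W"
  have col: "(\<Sum>i\<in>UNIV. ?Q $ i $ k * ?Q $ i $ l) = (if k = l then 1 else 0)" for k l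
    using assms
    by (simp add: orthogonal_mat_def vec_eq_iff matrix_matrix_mult_def transpose_def mat_def)
  have row: "(\<Sum>k\<in>UNIV. ?Q $ i $ k * ?Q $ j $ k) = (if i = j then 1 else 0)" for i j
    using assms
    by (simp add: orthogonal_mat_def vec_eq_iff matrix_matrix_mult_def transpose_def mat_def)
  show "transpose V ** V = mat 1"
    using col[of "Inl _" "Inl _"]
    by (simp add: append_columns_def vec_eq_iff matrix_matrix_mult_def transpose_def mat_def)
  show "transpose W ** W = mat 1"
    using col[of "Inr _" "Inr _"]
    by (simp add: append_columns_def vec_eq_iff matrix_matrix_mult_def transpose_def mat_def)
  show "transpose V ** W = 0"
    using col[of "Inl _" "Inr _"]
    by (simp add: append_columns_def vec_eq_iff matrix_matrix_mult_def transpose_def)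
  show "transpose W ** V = 0"
    using col[of "Inr _" "Inl _"]
    by (simp add: append_columns_def vec_eq_iff matrix_matrix_mult_def transpose_def)
  show "V ** transpose V + W ** transpose W = mat 1"
    using row
    by (simp add: sum_UNIV_Plus append_columns_def vec_eq_iff matrix_matrix_mult_def
        transpose_def mat_def)
qed

text \<open>A real matrix and a real factor act separately on the real and imaginary parts of a
  complex eigenvector, and one of these parts is nonzero.\<close>

lemma eigenvalue_of_map_matrix_complex_of_real:
  fixes M :: "real ^ 'n ^ 'n"
  assumes "eigenvalue_of (map_matrix complex_of_real M) (complex_of_real l)"
  shows "eigenvalue_of M l"
proof -
  obtain z where z: "z \<noteq> 0" "map_matrix complex_of_real M *v z = complex_of_real l *s z"
    using assms by (auto simp: eigenvalue_of_def)
  have eq: "(\<Sum>j\<in>UNIV. complex_of_real (M $ i $ j) * z $ j) = complex_of_real l * z $ i" for i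
    using z(2) by (simp add: vec_eq_iff matrix_vector_mult_def map_matrix_def)
  define x where "x = (\<chi> i. Re (z $ i))"
  define y where "y = (\<chi> i. Im (z $ i))"
  have "M *v x = l *s x"
    using arg_cong[OF eq, of Re] by (simp add: vec_eq_iff matrix_vector_mult_def x_def)
  moreover have "M *v y = l *s y"
    using arg_cong[OF eq, of Im] by (simp add: vec_eq_iff matrix_vector_mult_def y_def)
  moreover have "x \<noteq> 0 \<or> y \<noteq> 0"
    using z(1) by (auto simp: x_def y_def vec_eq_iff complex_eq_iff)
  ultimately show ?thesis
    unfolding eigenvalue_of_def by blast
qed

lemma diag_mult_vec_nth: "(diag d *v x) $ i = d $ i * x $ i" for d :: "'a::semiring_1 ^ 'n"
proof -
  have "(diag d *v x) $ i = (\<Sum>j\<in>UNIV. if i = j then d $ i * x $ j else 0)"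
    unfolding matrix_vector_mult_def diag_def vec_lambda_beta by (intro sum.cong) auto
  then show ?thesis
    by simp
qed

lemma eigenvalue_of_diag_iff: "eigenvalue_of (diag d) l \<longleftrightarrow> l \<in> range (($) d)"
proof
  assume "eigenvalue_of (diag d) l"
  then obtain x i where "diag d *v x = l *s x" "x $ i \<noteq> 0"
    by (auto simp: eigenvalue_of_def vec_eq_iff)
  then have "d $ i * x $ i = l * x $ i"
    by (metis diag_mult_vec_nth vector_smult_component)
  with \<open>x $ i \<noteq> 0\<close> show "l \<in> range (($) d)"
    by auto
next
  assume "l \<in> range (($) d)"
  then obtain i where i: "l = d $ i"
    by blast
  have "diag d *v axis i 1 = l *s axis i 1"
    by (simp add: vec_eq_iff diag_mult_vec_nth axis_def i)
  moreover have "axis i 1 \<noteq> (0 :: 'a ^ 'b)"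
    by (simp add: axis_eq_0_iff)
  ultimately show "eigenvalue_of (diag d) l"
    unfolding eigenvalue_of_def by blast
qed

text \<open>\<open>Max\<close> is an upper bound because the eigenvalues are the entries of
  \<open>d\<close>, a finite set.\<close>

lemma eigenvalue_le_lambda_max_diag:
  assumes "eigenvalue_of (diag d) l"
  shows "l \<le> lambda_max (diag d)"
  using assms by (auto simp: lambda_max_def eigenvalue_of_diag_iff intro!: Max_ge)

lemma norm_matrix_vector_mult_le: "norm (M *v x) \<le> spectral_norm M * norm x"
  unfolding spectral_norm_def by (rule onorm) simp

lemma spectral_norm_nonneg: "0 \<le> spectral_norm M"
  unfolding spectral_norm_def by (rule onorm_pos_le) simp

theorem theorem4p1:
  fixes A P :: "real ^ 'n ^ 'n"
    and V :: "real ^ 'r ^ 'n"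
    and Vp :: "real ^ 's ^ 'n"
    and lam :: "real ^ 'r"
    and lamp :: "real ^ 's"
    and H E rho :: "real ^ 'r ^ 'r"
    and xi :: real
  assumes dims: "CARD('n) = CARD('r) + CARD('s)"
    and spd: "symmetric_positive_definite A"
    and orth: "orthogonal_mat (append_columns V Vp)"
    and decomp: "A = V ** diag lam ** transpose V + Vp ** diag lamp ** transpose Vp"
    and ordered: "\<And>i j. lam $ i \<le> lamp $ j"
    and E: "E = transpose V ** A ** V"
    and H: "invertible H"
    and P: "P = mat 1 - A ** V ** matrix_inv H ** transpose V"
    and rho: "rho = E ** matrix_inv H - mat 1"
    and xi: "xi = spectral_norm rho * spectral_norm (diag lam)"
    and real_eigenvalues: "\<And>l. eigenvalue_of (map_matrix complex_of_real (P ** A)) l \<Longrightarrow> l \<in> \<real>"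
  shows "\<forall>l. eigenvalue_of (map_matrix complex_of_real (P ** A)) l \<longrightarrow>
           - xi \<le> Re l \<and> Re l \<le> lambda_max (diag lamp) + xi"
proof (intro allI impI)
  fix l
  assume ev: "eigenvalue_of (map_matrix complex_of_real (P ** A)) l"
  define L where "L = diag lam"
  define Lp where "Lp = diag lamp"
  note o = orthogonal_mat_append_columnsD[OF orth]
  note A = decomp[folded L_def Lp_def]
  \<comment> \<open>Multiplying the decomposition by a block from either side leaves one term, as
    the cross products of \<open>V\<close> and \<open>Vp\<close> vanish.\<close>
  have VA: "transpose V ** A = L ** transpose V"
    using o by (simp add: A matrix_add_ldistrib matrix_mul_assoc)
  have VpA: "transpose Vp ** A = Lp ** transpose Vp"
    using o by (simp add: A matrix_add_ldistrib matrix_mul_assoc)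
  have AV: "A ** V = V ** L"
    using o by (simp add: A matrix_add_rdistrib flip: matrix_mul_assoc)
  have AVp: "A ** Vp = Vp ** Lp"
    using o by (simp add: A matrix_add_rdistrib flip: matrix_mul_assoc)
  have EL: "E = L"
    using o by (metis E VA matrix_mul_assoc matrix_mul_rid)
  have LH: "L ** matrix_inv H = mat 1 + rho"
    using rho EL by simp
  \<comment> \<open>In the subtracted term \<open>AV\<close> and \<open>VA\<close> each bring out a
    factor \<open>L\<close>; the left one meets \<open>matrix_inv H\<close> and becomes
    \<open>mat 1 + rho\<close>.\<close>
  have PA: "P ** A = A - V ** (mat 1 + rho) ** L ** transpose V"
  proof -
    have "P ** A = A - A ** V ** matrix_inv H ** (transpose V ** A)"
      by (simp add: P matrix_diff_rdistrib matrix_mul_assoc)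
    also have "\<dots> = A - V ** (L ** matrix_inv H) ** L ** transpose V"
      by (simp only: AV VA matrix_mul_assoc)
    finally show ?thesis
      by (simp only: LH)
  qed
  \<comment> \<open>\<open>VPA\<close> and \<open>VpPA\<close> express the block diagonal form: the
    first involves only \<open>transpose V\<close>, the second only
    \<open>transpose Vp\<close>.\<close>
  have VPA: "transpose V ** (P ** A) = L ** transpose V - (mat 1 + rho) ** L ** transpose V"
    using o by (simp add: PA matrix_diff_ldistrib VA matrix_mul_assoc)
  have VpPA: "transpose Vp ** (P ** A) = Lp ** transpose Vp"
    using o by (simp add: PA matrix_diff_ldistrib VpA matrix_mul_assoc)

  \<comment> \<open>\<open>Vp\<close> maps an eigenvector of \<open>Lp\<close> to one of
    \<open>A\<close> with the same eigenvalue, which is positive by definiteness.\<close>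
  have Lp_pos: "m > 0" if m: "eigenvalue_of Lp m" for m
  proof -
    obtain b where b: "b \<noteq> 0" "Lp *v b = m *s b"
      using m unfolding eigenvalue_of_def by blast
    have bb: "transpose Vp *v (Vp *v b) = b"
      using o by (simp add: matrix_vector_mul_assoc del: transpose_matrix_vector)
    then have nz: "Vp *v b \<noteq> 0"
      using b(1) by (metis matrix_vector_mult_0_right)
    have "A *v (Vp *v b) = m *s (Vp *v b)"
      by (metis AVp b(2) matrix_vector_mul_assoc vector_scalar_commute)
    then have "(Vp *v b) \<bullet> (m *s (Vp *v b)) > 0"
      using spd nz unfolding symmetric_positive_definite_def by metis
    \<comment> \<open>The product of \<open>m\<close> and a squared length is positive;
      \<open>inner_ge_zero\<close> excludes that both factors are negative.\<close>
    then show ?thesis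
      using nz by (simp add: scalar_mult_eq_scaleR zero_less_mult_iff leD[OF inner_ge_zero])
  qed
  have lamp_max: "0 < lambda_max Lp"
  proof -
    \<comment> \<open>Any index would do: \<open>undefined\<close> only names an element of the
      nonempty index type.\<close>
    have ex: "eigenvalue_of Lp (lamp $ undefined)"
      by (simp add: Lp_def eigenvalue_of_diag_iff)
    then show ?thesis
      using Lp_pos[OF ex] eigenvalue_le_lambda_max_diag[OF ex[unfolded Lp_def]]
      by (simp add: Lp_def)
  qed
  have xi_nonneg: "0 \<le> xi"
    by (simp add: xi spectral_norm_nonneg)

  \<comment> \<open>Realness of \<open>l\<close> yields a real eigenvector, to which the real
    spectral norm estimates apply.\<close>
  have l: "l = complex_of_real (Re l)"
    using real_eigenvalues[OF ev] by simp
  then have "eigenvalue_of (P ** A) (Re l)"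
    using ev eigenvalue_of_map_matrix_complex_of_real by metis
  then obtain x where x: "x \<noteq> 0" "(P ** A) *v x = Re l *s x"
    unfolding eigenvalue_of_def by blast
  define a where "a = transpose V *v x"
  define b where "b = transpose Vp *v x"
  have a: "- (rho *v (L *v a)) = Re l *s a"
  proof -
    have "Re l *s a = (transpose V ** (P ** A)) *v x"
      by (metis a_def matrix_vector_mul_assoc vector_scalar_commute x(2))
    also have "\<dots> = L *v a - (mat 1 + rho) *v (L *v a)"
      unfolding VPA
      by (simp only: a_def matrix_vector_mult_diff_rdistrib matrix_vector_mul_assoc
          matrix_mul_assoc)
    finally show ?thesis
      by (simp add: matrix_vector_mult_add_rdistrib)
  qed
  have b: "Lp *v b = Re l *s b"
    by (metis VpPA b_def matrix_vector_mul_assoc vector_scalar_commute x(2))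
  \<comment> \<open>Completeness of the basis \<open>(V, Vp)\<close>: the coordinates
    \<open>a\<close> and \<open>b\<close> of \<open>x\<close> cannot both vanish.\<close>
  have "x = V *v a + Vp *v b"
    using o(5) by (metis a_def b_def matrix_vector_mul_assoc matrix_vector_mul_lid
        matrix_vector_mult_add_rdistrib)
  with x(1) have "a \<noteq> 0 \<or> b \<noteq> 0"
    by auto
  then have "- xi \<le> Re l \<and> Re l \<le> lambda_max Lp + xi"
  proof
    assume "b \<noteq> 0"
    with b have ev_Lp: "eigenvalue_of Lp (Re l)"
      unfolding eigenvalue_of_def by blast
    show ?thesis
      using Lp_pos[OF ev_Lp] eigenvalue_le_lambda_max_diag[OF ev_Lp[unfolded Lp_def]] xi_nonneg
      by (simp add: Lp_def)
  next
    assume "a \<noteq> 0"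
    have "\<bar>Re l\<bar> * norm a = norm (rho *v (L *v a))"
      using arg_cong[OF a, of norm] by (simp add: scalar_mult_eq_scaleR)
    also have "\<dots> \<le> spectral_norm rho * norm (L *v a)"
      by (rule norm_matrix_vector_mult_le)
    also have "\<dots> \<le> spectral_norm rho * (spectral_norm L * norm a)"
      by (intro mult_left_mono norm_matrix_vector_mult_le spectral_norm_nonneg)
    finally have "\<bar>Re l\<bar> * norm a \<le> xi * norm a"
      by (simp add: xi L_def mult.assoc)
    with \<open>a \<noteq> 0\<close> have "\<bar>Re l\<bar> \<le> xi"
      by simp
    \<comment> \<open>Positivity of \<open>lambda_max Lp\<close> weakens
      \<open>Re l \<le> xi\<close> to the claimed upper bound.\<close>
    with lamp_max show ?thesis
      by linarith
  qed
  then show "- xi \<le> Re l \<and> Re l \<le> lambda_max (diag lamp) + xi"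
    by (simp add: Lp_def)
qed

end
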